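(* Let $d,p,q\ge1$ be integers, let $A(z)=I_d-A_1z-\cdots-A_pz^p$ and $B(z)=I_d+B_1z+\cdots+B_qz^q$ with $A_i,B_j$ real $d\times d$ matrices, and let $\Gamma$ be a positive definite symmetric real $d\times d$ matrix. Assume that $\det B(z)\neq0$ for all $z\in\mathbb{C}$ with $|z|\le1$, and let $\Pi,H,K,L$ be the matrices defined in the context. Let $$\Lambda=\begin{pmatrix} L & K^t\\ K & H\end{pmatrix},\qquad S=H-KL^{-1}K^t,$$ so that $S$ is the Schur complement of $L$ in $\Lambda$. If $\det(\Pi)\neq0$, then $S$ and $\Lambda$ are invertible and $$\Lambda^{-1}=\begin{pmatrix} L^{-1}+L^{-1}K^tS^{-1}KL^{-1} & -L^{-1}K^tS^{-1}\\ -S^{-1}KL^{-1} & S^{-1}\end{pmatrix}.$$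
   Context: $^t$ denotes transpose. Since $\det B(z)\ne0$ for $|z|\le1$, $B^{-1}(z)$ is holomorphic on a disc of radius $>1$, and the $d\times d$ matrices $P_k$ are defined by the power series $B^{-1}(z)(A(z)-I_d)=\sum_{k=1}^\infty P_kz^k$ on that disc. Put $P_k=0$ for $k\le0$. - $\Pi$ is the $dq\times dq$ matrix whose $(i,j)$ block of size $d\times d$ is $P_{p+j-i}$, $1\le i,j\le q$. - $L$ is the $dp\times dp$ block diagonal matrix $\mathrm{diag}(\Gamma,\dots,\Gamma)$. - $K$ is the $dq\times dp$ matrix whose $(i,j)$ block ($1\le i\le q$, $1\le j\le p$) is $P_{j-i}\Gamma$ if $j>i$ and $0$ otherwise. - For $1\le i\le q$, $H_i=\sum_{k=i}^\infty P_k\Gamma P_{k-i+1}^t$. $H$ is the symmetric $dq\times dq$ matrix whose $(i,j)$ block is $H_{j-i+1}$ if $j\ge i$ and $H_{i-j+1}^t$ if $j<i$. *)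

theory Defs
  imports
    "HOL-Complex_Analysis.Complex_Analysis"
    "Jordan_Normal_Form.Determinant"
    "Jordan_Normal_Form.Gauss_Jordan_Elimination"
begin

unbundle no inner_syntax
unbundle no vec_syntax

(* Unspecified on singular matrices, where mat_inverse returns None. *)
definition inv_mat :: "'a::field mat \<Rightarrow> 'a mat" where
  "inv_mat M = the (mat_inverse M)"

definition sym_pos_def :: "nat \<Rightarrow> real mat \<Rightarrow> bool" where
  "sym_pos_def d M \<longleftrightarrow> M \<in> carrier_mat d d \<and> M\<^sup>T = M \<and>
     (\<forall>v \<in> carrier_vec d. v \<noteq> 0\<^sub>v d \<longrightarrow> v \<bullet> (M *\<^sub>v v) > 0)"

(* C_1 z + ... + C_n z^n for real d x d matrices C_k and complex z. *)
definition mat_poly :: "nat \<Rightarrow> nat \<Rightarrow> (nat \<Rightarrow> real mat) \<Rightarrow> complex \<Rightarrow> complex mat" where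
  "mat_poly d n C z = mat d d (\<lambda>(a, b). \<Sum>k = 1..n. complex_of_real (C k $$ (a, b)) * z ^ k)"

definition A_poly :: "nat \<Rightarrow> nat \<Rightarrow> (nat \<Rightarrow> real mat) \<Rightarrow> complex \<Rightarrow> complex mat" where
  "A_poly d p A z = 1\<^sub>m d - mat_poly d p A z"

definition B_poly :: "nat \<Rightarrow> nat \<Rightarrow> (nat \<Rightarrow> real mat) \<Rightarrow> complex \<Rightarrow> complex mat" where
  "B_poly d q B z = 1\<^sub>m d + mat_poly d q B z"

(* P_k is the k-th coefficient, taken entrywise, of the power series at 0 of
   B(z)^{-1} (A(z) - I_d). As all A_i and B_j are real, these coefficients are real
   numbers, so Re only changes the type. *)
definition P_coeff ::
  "nat \<Rightarrow> nat \<Rightarrow> nat \<Rightarrow> (nat \<Rightarrow> real mat) \<Rightarrow> (nat \<Rightarrow> real mat) \<Rightarrow> int \<Rightarrow> real mat" where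
  "P_coeff d p q A B k =
     (if k \<le> 0 then 0\<^sub>m d d
      else mat d d (\<lambda>(a, b). Re (fps_nth
        (fps_expansion (\<lambda>z. (inv_mat (B_poly d q B z) * (A_poly d p A z - 1\<^sub>m d)) $$ (a, b)) 0)
        (nat k))))"

(* The (m d) x (n d) matrix whose (i, j) block of size d x d is F i j, where the block
   indices i = 1, ..., m and j = 1, ..., n start at 1 (matrix entries start at 0). *)
definition block_mat :: "nat \<Rightarrow> nat \<Rightarrow> nat \<Rightarrow> (nat \<Rightarrow> nat \<Rightarrow> 'a mat) \<Rightarrow> 'a mat" where
  "block_mat d m n F = mat (m * d) (n * d)
     (\<lambda>(r, c). F (r div d + 1) (c div d + 1) $$ (r mod d, c mod d))"

definition Pi_mat :: "nat \<Rightarrow> nat \<Rightarrow> nat \<Rightarrow> (int \<Rightarrow> real mat) \<Rightarrow> real mat" where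
  "Pi_mat d p q P = block_mat d q q (\<lambda>i j. P (int p + int j - int i))"

definition L_mat :: "nat \<Rightarrow> real mat \<Rightarrow> real mat" where
  "L_mat p \<Gamma> = diag_block_mat (replicate p \<Gamma>)"

definition K_mat :: "nat \<Rightarrow> nat \<Rightarrow> nat \<Rightarrow> (int \<Rightarrow> real mat) \<Rightarrow> real mat \<Rightarrow> real mat" where
  "K_mat d p q P \<Gamma> = block_mat d q p
     (\<lambda>i j. if j > i then P (int j - int i) * \<Gamma> else 0\<^sub>m d d)"

(* The sum over k >= i of P_k \<Gamma> P_{k-i+1}^t, taken entrywise and with k = n + i. *)
definition H_coeff :: "nat \<Rightarrow> (int \<Rightarrow> real mat) \<Rightarrow> real mat \<Rightarrow> nat \<Rightarrow> real mat" where
  "H_coeff d P \<Gamma> i = mat d d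
     (\<lambda>(a, b). \<Sum>n. (P (int (n + i)) * \<Gamma> * (P (int (n + 1)))\<^sup>T) $$ (a, b))"

definition H_mat :: "nat \<Rightarrow> nat \<Rightarrow> (int \<Rightarrow> real mat) \<Rightarrow> real mat \<Rightarrow> real mat" where
  "H_mat d q P \<Gamma> = block_mat d q q
     (\<lambda>i j. if j \<ge> i then H_coeff d P \<Gamma> (j - i + 1) else (H_coeff d P \<Gamma> (i - j + 1))\<^sup>T)"

end

theory Submission
  imports Defs
begin

text \<open>
  With $P_k = 0$ for $k \le 0$, the $(i,j)$ block of $H$ is $\sum_{l \ge 1} P_{l-i} \Gamma P_{l-j}^t$,
  and the terms with $l \le p$ add up to the $(i,j)$ block of $K L^{-1} K^t$. Hence
  $v^t S v = \sum_{l > p} w_l^t \Gamma w_l$ with $w_l = \sum_i P_{l-i}^t v_i$. If this is not positive,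
  then $w_l = 0$ for all $l > p$; as $w_{p+1}, \dots, w_{p+q}$ are the blocks of $\Pi^t v$, this forces
  $v = 0$. So $S$ is invertible, and block elimination inverts $\Lambda$. The series converge because
  $B^{-1}$ is holomorphic on a disc of radius greater than 1.
\<close>

section \<open>Matrix inverses and block elimination\<close>

lemma inv_mat:
  fixes M :: "'a::field mat"
  assumes M: "M \<in> carrier_mat n n" and det: "det M \<noteq> 0"
  shows "inv_mat M \<in> carrier_mat n n" "M * inv_mat M = 1\<^sub>m n" "inv_mat M * M = 1\<^sub>m n"
proof -
  \<comment> \<open>\<open>mat_inverse\<close> fails only on non-units of the matrix ring. The unit
    value \<open>()\<close> fills the extension slot of the ring record, so that both facts speak of
    the same ring.\<close>
  have "mat_inverse M \<noteq> None"
    using mat_inverse(1)[OF M, of "()"] det_non_zero_imp_unit[OF M det, of "()"] by blast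
  then have "mat_inverse M = Some (inv_mat M)"
    by (auto simp: inv_mat_def)
  from mat_inverse(2)[OF M this]
  show "inv_mat M \<in> carrier_mat n n" "M * inv_mat M = 1\<^sub>m n" "inv_mat M * M = 1\<^sub>m n"
    by auto
qed

text \<open>Since det is multiplicative, a right inverse already forces a nonzero determinant, and
  then cancelling from the left identifies it. So only one of the two products ever has to be
  checked.\<close>

lemma inv_mat_eqI:
  fixes M :: "'a::field mat"
  assumes M: "M \<in> carrier_mat n n" and N: "N \<in> carrier_mat n n" and MN: "M * N = 1\<^sub>m n"
  shows "det M \<noteq> 0" "inv_mat M = N"
proof -
  show det: "det M \<noteq> 0"
    using det_mult[OF M N] MN by auto
  note inv = inv_mat[OF M det]
  have "inv_mat M = inv_mat M * (M * N)"
    using inv MN by simp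
  also have "\<dots> = inv_mat M * M * N"
    by (rule assoc_mult_mat[symmetric, OF inv(1) M N])
  finally show "inv_mat M = N"
    using inv N by simp
qed

lemma invertible_mat_if_det_nonzero:
  fixes M :: "'a::field mat"
  assumes "M \<in> carrier_mat n n" "det M \<noteq> 0"
  shows "invertible_mat M"
  using inv_mat[OF assms] assms(1)
  by (auto simp: invertible_mat_def inverts_mat_def intro!: exI[of _ "inv_mat M"])

text \<open>Stated with dimensions instead of carriers, so that the simplifier can reassociate long
  products without guessing sizes.\<close>

lemma mult_mat_assoc_dim:
  fixes A B C :: "'a::semiring_0 mat"
  assumes "dim_col A = dim_row B" "dim_col B = dim_row C"
  shows "A * B * C = A * (B * C)"
  using assms by (intro assoc_mult_mat) auto

text \<open>Substituting H = S + K L^{-1} U into the block product leaves only cancellations L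
  L^{-1} = I and S S^{-1} = I. The block U becomes K^t in the application.\<close>

lemma four_block_mat_schur_inverse:
  fixes L U K H S :: "'a::field mat"
  assumes L: "L \<in> carrier_mat n n" and U: "U \<in> carrier_mat n m"
    and K: "K \<in> carrier_mat m n" and H: "H \<in> carrier_mat m m"
    and S: "S = H - K * inv_mat L * U"
    and detL: "det L \<noteq> 0" and detS: "det S \<noteq> 0"
  shows "four_block_mat L U K H * four_block_mat
      (inv_mat L + inv_mat L * U * inv_mat S * K * inv_mat L)
      (- (inv_mat L * U * inv_mat S))
      (- (inv_mat S * K * inv_mat L))
      (inv_mat S) = 1\<^sub>m (n + m)"
proof -
  define Li where "Li = inv_mat L"
  define Si where "Si = inv_mat S"
  have Li: "Li \<in> carrier_mat n n" "L * Li = 1\<^sub>m n"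
    using inv_mat[OF L detL] by (auto simp: Li_def)
  have Sc: "S \<in> carrier_mat m m"
    using H K U Li by (auto simp: S Li_def[symmetric])
  have Si: "Si \<in> carrier_mat m m" "S * Si = 1\<^sub>m m"
    using inv_mat[OF Sc detS] by (auto simp: Si_def)
  \<comment> \<open>In these terms the candidate inverse has the blocks \<open>Li + Li * W\<close>,
    \<open>- (Li * V)\<close>, \<open>- Y\<close> and \<open>Si\<close>, and a leading L cancels
    \<open>Li\<close> at once.\<close>
  define V where "V = U * Si"
  define W where "W = U * Si * K * Li"
  define Y where "Y = Si * K * Li"
  have V: "V \<in> carrier_mat n m" using U Si by (auto simp: V_def)
  have Y: "Y \<in> carrier_mat m n" using K Li Si by (auto simp: Y_def)
  have W: "W \<in> carrier_mat n n" using U K Li Si by (auto simp: W_def)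
  note dims = carrier_matD[OF L] carrier_matD[OF U] carrier_matD[OF K]
    carrier_matD[OF Li(1)] carrier_matD[OF Si(1)]
  have UY: "U * Y = W"
    unfolding Y_def W_def by (simp add: mult_mat_assoc_dim dims)
  have LiV: "Li * U * Si = Li * V"
    unfolding V_def by (simp add: mult_mat_assoc_dim dims)
  have LiW: "Li * U * Si * K * Li = Li * W"
    unfolding W_def by (simp add: mult_mat_assoc_dim dims)
  have LLi: "L * (Li * X) = X" if "X \<in> carrier_mat n k" for X k
    using that Li L assoc_mult_mat[OF L Li(1) that] by simp
  have KLiV: "K * (Li * V) = K * Li * U * Si"
    unfolding V_def by (simp add: mult_mat_assoc_dim dims)
  have SY: "S * Y = K * Li"
  proof -
    have "S * Y = S * Si * (K * Li)"
      unfolding Y_def by (simp add: mult_mat_assoc_dim dims carrier_matD[OF Sc])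
    then show ?thesis
      using Si K Li by simp
  qed
  have KLiW: "K * (Li * W) = K * Li * U * Y"
    unfolding W_def Y_def by (simp add: mult_mat_assoc_dim dims)
  have HX: "H * X = S * X + K * Li * U * X" if "X \<in> carrier_mat m k" for X k
  proof -
    have "H = S + K * Li * U"
      unfolding S Li_def[symmetric] using H K Li U by auto
    then show ?thesis
      using add_mult_distrib_mat[OF Sc _ that, of "K * Li * U"] K Li U by auto
  qed
  have b11: "L * (Li + Li * W) + U * (- Y) = 1\<^sub>m n"
  proof -
    have "L * (Li + Li * W) = 1\<^sub>m n + W"
      using mult_add_distrib_mat[OF L Li(1), of "Li * W"] Li W LLi[OF W] by auto
    moreover have "U * (- Y) = - W"
      using U Y UY by (simp add: uminus_mult_right_mat)
    ultimately show ?thesis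
      using W by auto
  qed
  have b12: "L * (- (Li * V)) + U * Si = 0\<^sub>m n m"
  proof -
    have "L * (- (Li * V)) = - V"
      using L Li V LLi[OF V] by (simp add: uminus_mult_right_mat)
    then show ?thesis
      using V by (auto simp: V_def[symmetric])
  qed
  have b21: "K * (Li + Li * W) + H * (- Y) = 0\<^sub>m m n"
  proof -
    have "K * (Li + Li * W) = K * Li + K * Li * U * Y"
      using mult_add_distrib_mat[OF K Li(1), of "Li * W"] Li W KLiW by auto
    moreover have "H * (- Y) = - (K * Li + K * Li * U * Y)"
      using H Y HX[OF Y] SY by (simp add: uminus_mult_right_mat)
    ultimately show ?thesis
      using K Li U Y by auto
  qed
  have b22: "K * (- (Li * V)) + H * Si = 1\<^sub>m m"
  proof -
    have "K * (- (Li * V)) = - (K * Li * U * Si)"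
      using K Li V KLiV by (simp add: uminus_mult_right_mat)
    moreover have "H * Si = 1\<^sub>m m + K * Li * U * Si"
      using HX[OF Si(1)] Si by simp
    ultimately show ?thesis
      using K Li U Si by auto
  qed
  show ?thesis
    unfolding Li_def[symmetric] Si_def[symmetric]
    \<comment> \<open>\<open>LiW\<close> has to be rewritten first: its left-hand side contains that
      of \<open>LiV\<close>.\<close>
    unfolding LiW
    unfolding LiV Y_def[symmetric]
    by (subst mult_four_block_mat[OF L U K H, of _ n _ m])
      (use Li V W Y Si b11 b12 b21 b22 in auto)
qed

section \<open>Holomorphy of the inverse and summability of the coefficients\<close>

lemma holomorphic_on_det:
  assumes M: "\<And>z. M z \<in> carrier_mat n n"
    and hol: "\<And>i j. i < n \<Longrightarrow> j < n \<Longrightarrow> (\<lambda>z. M z $$ (i, j)) holomorphic_on U"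
  shows "(\<lambda>z. det (M z)) holomorphic_on U"
  unfolding det_def'[OF M]
  by (intro holomorphic_intros hol) (auto dest: permutes_in_image)

text \<open>By Cramer's rule each entry of the inverse is a cofactor divided by the determinant, and
  a cofactor is, up to sign, the determinant of a minor.\<close>

lemma holomorphic_on_inv_mat:
  assumes M: "\<And>z. M z \<in> carrier_mat n n"
    and hol: "\<And>i j. i < n \<Longrightarrow> j < n \<Longrightarrow> (\<lambda>z. M z $$ (i, j)) holomorphic_on U"
    and det: "\<And>z. z \<in> U \<Longrightarrow> det (M z) \<noteq> 0"
    and ij: "i < n" "j < n"
  shows "(\<lambda>z. inv_mat (M z) $$ (i, j)) holomorphic_on U"
proof -
  have eq: "inv_mat (M z) $$ (i, j) = cofactor (M z) j i / det (M z)" if z: "z \<in> U" for z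
  proof -
    have adj: "adj_mat (M z) \<in> carrier_mat n n"
      using adj_mat(1)[OF M] .
    have "inv_mat (M z) = inverse (det (M z)) \<cdot>\<^sub>m adj_mat (M z)"
    proof (rule inv_mat_eqI(2)[OF M])
      show "inverse (det (M z)) \<cdot>\<^sub>m adj_mat (M z) \<in> carrier_mat n n"
        using adj by simp
      have "M z * (inverse (det (M z)) \<cdot>\<^sub>m adj_mat (M z)) = inverse (det (M z)) \<cdot>\<^sub>m (M z * adj_mat (M z))"
        by (rule mult_smult_distrib[OF M adj])
      also have "\<dots> = 1\<^sub>m n"
        unfolding adj_mat(2)[OF M] using det[OF z] by (intro eq_matI) auto
      finally show "M z * (inverse (det (M z)) \<cdot>\<^sub>m adj_mat (M z)) = 1\<^sub>m n" .
    qed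
    then show ?thesis
      using adj ij M[of z] by (simp add: adj_mat_def divide_inverse mult.commute)
  qed
  have "(\<lambda>z. det (mat_delete (M z) j i)) holomorphic_on U"
  proof (rule holomorphic_on_det)
    show "mat_delete (M z) j i \<in> carrier_mat (n - 1) (n - 1)" for z
      using M[of z] by (intro carrier_matI) auto
    show "(\<lambda>z. mat_delete (M z) j i $$ (k, l)) holomorphic_on U"
      if "k < n - 1" "l < n - 1" for k l
    proof -
      have "(\<lambda>z. mat_delete (M z) j i $$ (k, l)) =
        (\<lambda>z. M z $$ (if k < j then k else Suc k, if l < i then l else Suc l))"
        using that by (simp add: mat_delete_def carrier_matD[OF M])
      then show ?thesis
        using that by (auto intro!: hol)
    qed
  qed
  then have "(\<lambda>z. cofactor (M z) j i / det (M z)) holomorphic_on U"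
    unfolding cofactor_def
    by (intro holomorphic_intros holomorphic_on_det[OF M hol]) (use det in auto)
  then show ?thesis
    using eq by (simp cong: holomorphic_cong)
qed

text \<open>By compactness some uniform e-neighbourhood of the closed disc lies in U; a point with 1
  < |z| < 1 + e is within e of its radial projection z/|z|.\<close>

lemma ball_subset_open_superset_cball:
  fixes U :: "complex set"
  assumes "open U" "cball 0 1 \<subseteq> U"
  obtains r where "r > 1" "ball 0 r \<subseteq> U"
proof -
  obtain e where e: "e > 0" "(\<Union>x\<in>cball 0 1. ball x e) \<subseteq> U"
    using compact_subset_open_imp_ball_epsilon_subset[OF compact_cball assms] by blast
  have "ball 0 (1 + e) \<subseteq> U"
  proof
    fix z :: complex
    assume z: "z \<in> ball 0 (1 + e)"
    show "z \<in> U"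
    proof (cases "norm z \<le> 1")
      case False
      then have "z / norm z - z = of_real (1 - norm z) * (z / norm z)"
        by (auto simp: divide_simps algebra_simps)
      then have "dist (z / norm z) z = \<bar>1 - norm z\<bar> * norm (z / norm z)"
        by (simp only: dist_norm norm_mult norm_of_real)
      also have "\<dots> = norm z - 1"
        using False by (auto simp: norm_divide)
      finally have "z \<in> ball (z / norm z) e"
        using z by (simp add: dist_norm)
      moreover have "z / norm z \<in> cball 0 1"
        using False by (simp add: norm_divide)
      ultimately show ?thesis
        using e(2) by blast
    qed (use assms(2) in auto)
  qed
  then show ?thesis
    using that[of "1 + e"] e(1) by auto
qed

text \<open>The radius of convergence is at least r > 1, so the series converges absolutely at the
  point 1.\<close>

lemma summable_norm_fps_expansion:
  assumes hol: "f holomorphic_on ball 0 r" and r: "r > 1"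
  shows "summable (\<lambda>n. norm (fps_nth (fps_expansion f 0) n))"
proof -
  have "ereal r \<le> fps_conv_radius (fps_expansion f 0)"
    by (rule conv_radius_fps_expansion) (use hol in simp)
  then have "ereal (norm (1::complex)) < fps_conv_radius (fps_expansion f 0)"
    by (rule less_le_trans[rotated]) (use r in simp)
  from abs_summable_in_conv_radius[OF this[unfolded fps_conv_radius_def]]
  show ?thesis by (simp only: power_one mult_1_right)
qed

lemma P_coeff_carrier: "P_coeff d p q A B k \<in> carrier_mat d d"
  by (simp add: P_coeff_def)

lemma P_coeff_nonpos: "k \<le> 0 \<Longrightarrow> P_coeff d p q A B k = 0\<^sub>m d d"
  by (simp add: P_coeff_def)

text \<open>The set where det B(z) is nonzero is open and contains the closed unit disc, hence a
  disc of radius r > 1. There the entries of B^{-1}(A - I) are holomorphic.\<close>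

lemma summable_P_coeff:
  assumes det: "\<And>z::complex. norm z \<le> 1 \<Longrightarrow> det (B_poly d q B z) \<noteq> 0"
    and ab: "a < d" "b < d"
  shows "summable (\<lambda>n. \<bar>P_coeff d p q A B (int n) $$ (a, b)\<bar>)"
proof -
  define U where "U = {z. det (B_poly d q B z) \<noteq> 0}"
  have B: "B_poly d q B z \<in> carrier_mat d d" for z
    by (simp add: B_poly_def mat_poly_def)
  have holB: "(\<lambda>z. B_poly d q B z $$ (i, j)) holomorphic_on V" if "i < d" "j < d" for i j V
    using that by (auto simp: B_poly_def mat_poly_def intro!: holomorphic_intros)
  have "continuous_on UNIV (\<lambda>z. det (B_poly d q B z))"
    by (intro holomorphic_on_imp_continuous_on holomorphic_on_det[OF B holB])
  then have "open U"
    unfolding U_def by (intro open_Collect_neq continuous_intros)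
  moreover have "cball 0 1 \<subseteq> U"
    using det by (auto simp: U_def)
  ultimately obtain r where r: "r > 1" "ball 0 r \<subseteq> U"
    using ball_subset_open_superset_cball by blast
  define f where "f = (\<lambda>z. (inv_mat (B_poly d q B z) * (A_poly d p A z - 1\<^sub>m d)) $$ (a, b))"
  \<comment> \<open>The entry of the product is treated as an explicit sum, because the dimensions
    of \<open>inv_mat\<close> are known only where the determinant is nonzero; \<open>eq\<close>
    transfers the result on the ball.\<close>
  have hol: "(\<lambda>z. \<Sum>c<d. inv_mat (B_poly d q B z) $$ (a, c) * (A_poly d p A z - 1\<^sub>m d) $$ (c, b)) 
    holomorphic_on ball 0 r"
  proof (intro holomorphic_intros holomorphic_on_inv_mat[OF B holB])
    show "det (B_poly d q B z) \<noteq> 0" if "z \<in> ball 0 r" for z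
      using that r(2) by (auto simp: U_def)
    show "(\<lambda>z. (A_poly d p A z - 1\<^sub>m d) $$ (c, b)) holomorphic_on ball 0 r"
      if "c \<in> {..<d}" for c
      using that ab by (auto simp: A_poly_def mat_poly_def intro!: holomorphic_intros)
  qed (use ab in auto)
  have eq: "f z = (\<Sum>c<d. inv_mat (B_poly d q B z) $$ (a, c) * (A_poly d p A z - 1\<^sub>m d) $$ (c, b))"
    if "z \<in> ball 0 r" for z
  proof -
    have "inv_mat (B_poly d q B z) \<in> carrier_mat d d"
      using that r(2) by (intro inv_mat(1)[OF B]) (auto simp: U_def)
    moreover have "A_poly d p A z - 1\<^sub>m d \<in> carrier_mat d d"
      by (intro minus_carrier_mat) simp
    ultimately show ?thesis
      unfolding f_def using ab
      by (auto simp: scalar_prod_def atLeast0LessThan intro!: sum.cong)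
  qed
  have "f holomorphic_on ball 0 r"
    by (rule holomorphic_transform[OF hol]) (simp add: eq)
  then have "summable (\<lambda>n. norm (fps_nth (fps_expansion f 0) n))"
    using summable_norm_fps_expansion r(1) by blast
  then show ?thesis
  proof (rule summable_comparison_test')
    show "norm \<bar>P_coeff d p q A B (int n) $$ (a, b)\<bar> \<le> norm (fps_nth (fps_expansion f 0) n)" for n
      using ab abs_Re_le_cmod by (auto simp: P_coeff_def f_def)
  qed
qed

section \<open>Quadratic forms, series and block indices\<close>

lemma det_nonzero_if_quadratic_form_pos:
  fixes M :: "real mat"
  assumes M: "M \<in> carrier_mat n n"
    and pos: "\<And>v. v \<in> carrier_vec n \<Longrightarrow> v \<noteq> 0\<^sub>v n \<Longrightarrow> v \<bullet> (M *\<^sub>v v) > 0"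
  shows "det M \<noteq> 0"
proof
  assume "det M = 0"
  then obtain v where v: "v \<in> carrier_vec n" "v \<noteq> 0\<^sub>v n" "M *\<^sub>v v = 0\<^sub>v n"
    using det_0_iff_vec_prod_zero[OF M] by auto
  then show False
    using pos[of v] by simp
qed

lemma sum_lessThan_times:
  fixes f :: "nat \<Rightarrow> 'a::comm_monoid_add"
  shows "(\<Sum>c<p * d. f c) = (\<Sum>l<p. \<Sum>k<d. f (l * d + k))"
proof -
  have "sum f {l * d..<l * d + d} = (\<Sum>k<d. f (l * d + k))" for l
    using sum.shift_bounds_nat_ivl[of f 0 "l * d" d]
    by (simp add: atLeast0LessThan add.commute)
  then show ?thesis
    using sum.nat_group[of f d p] by simp
qed

lemma index_mult_mult_transpose:
  fixes X Y G :: "'a::comm_semiring_0 mat"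
  assumes "X \<in> carrier_mat m d" "G \<in> carrier_mat d d" "Y \<in> carrier_mat n d" "a < m" "b < n"
  shows "(X * G * Y\<^sup>T) $$ (a, b) = (\<Sum>e<d. (\<Sum>c<d. X $$ (a, c) * G $$ (c, e)) * Y $$ (b, e))"
proof -
  have "(Z * Y\<^sup>T) $$ (a, b) = (\<Sum>e<d. Z $$ (a, e) * Y $$ (b, e))"
    if "Z \<in> carrier_mat m d" for Z
    using assms that by (simp add: scalar_prod_def atLeast0LessThan)
  from this[of "X * G"] show ?thesis
    using assms by (simp add: scalar_prod_def atLeast0LessThan)
qed

text \<open>For symmetric G the transpose of X G Y^t is Y G X^t. This handles the blocks of H below
  the diagonal.\<close>

lemma index_mult_mult_transpose_sym:
  fixes X Y G :: "'a::comm_semiring_0 mat"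
  assumes "X \<in> carrier_mat m d" "G \<in> carrier_mat d d" "Y \<in> carrier_mat n d" "a < m" "b < n"
    and Gsym: "G\<^sup>T = G"
  shows "(X * G * Y\<^sup>T) $$ (a, b) = (Y * G * X\<^sup>T) $$ (b, a)"
proof -
  have "(X * G * Y\<^sup>T)\<^sup>T = Y * (G * X\<^sup>T)"
    using assms transpose_mult[of "X * G" m d "Y\<^sup>T" n] transpose_mult[of X m d G d] by simp
  also have "\<dots> = Y * G * X\<^sup>T"
    using assms by (intro assoc_mult_mat[symmetric]) auto
  finally have "(Y * G * X\<^sup>T) $$ (b, a) = (X * G * Y\<^sup>T)\<^sup>T $$ (b, a)"
    by (rule arg_cong[OF sym])
  also have "\<dots> = (X * G * Y\<^sup>T) $$ (a, b)"
    using assms by (intro index_transpose_mat(1)) auto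
  finally show ?thesis ..
qed

text \<open>A summable sequence is bounded, so a constant multiple of |f n| dominates the
  products.\<close>

lemma summable_mult_abs:
  fixes f g :: "nat \<Rightarrow> real"
  assumes f: "summable (\<lambda>n. \<bar>f n\<bar>)" and g: "summable (\<lambda>n. \<bar>g n\<bar>)"
  shows "summable (\<lambda>n. f n * g n)"
proof -
  obtain C where C: "\<And>n. norm (g n) \<le> C"
    using summable_imp_Bseq[OF summable_rabs_cancel[OF g]] by (auto simp: Bseq_def)
  show ?thesis
  proof (rule summable_comparison_test')
    show "summable (\<lambda>n. \<bar>f n\<bar> * C)"
      by (rule summable_mult2[OF f])
    show "norm (f n * g n) \<le> \<bar>f n\<bar> * C" for n
      using C[of n] by (simp add: abs_mult mult_left_mono)
  qed
qed

text \<open>For fixed v the form is a finite linear combination of the matrix entries, so entrywise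
  convergence carries over.\<close>

lemma sums_quadratic_form:
  fixes S :: "real mat" and M :: "nat \<Rightarrow> real mat"
  assumes S: "S \<in> carrier_mat N N" and M: "\<And>n. M n \<in> carrier_mat N N"
    and sums: "\<And>r s. r < N \<Longrightarrow> s < N \<Longrightarrow> (\<lambda>n. M n $$ (r, s)) sums (S $$ (r, s))"
    and v: "v \<in> carrier_vec N"
  shows "(\<lambda>n. v \<bullet> (M n *\<^sub>v v)) sums (v \<bullet> (S *\<^sub>v v))"
proof -
  have quad: "v \<bullet> (X *\<^sub>v v) = (\<Sum>r<N. vec_index v r * (\<Sum>s<N. X $$ (r, s) * vec_index v s))"
    if "X \<in> carrier_mat N N" for X :: "real mat"
    using that v by (simp add: scalar_prod_def atLeast0LessThan)
  show ?thesis
    unfolding quad[OF S] quad[OF M]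
    by (intro sums_sum sums_mult sums_mult2 sums) auto
qed

lemma block_index_less:
  fixes r :: nat
  assumes "r < m * d"
  shows "r div d < m" "r mod d < d"
  using assms by (auto simp: less_mult_imp_div_less intro!: mod_less_divisor gr0I)

lemma index_of_block_less:
  fixes l :: nat
  assumes "l < p" "k < d"
  shows "l * d + k < p * d"
proof -
  have "l * d + k < Suc l * d"
    using assms by simp
  also have "\<dots> \<le> p * d"
    using assms by (intro mult_le_mono1) simp
  finally show ?thesis .
qed

section \<open>The block diagonal matrix L\<close>

text \<open>The carrier of \<open>L_mat p \<Gamma>\<close> determines the sizes of the zero blocks.
  It is assumed here because \<open>L_mat_carrier\<close> is itself proved by induction through this
  equation.\<close>

lemma L_mat_Suc:
  assumes "\<Gamma> \<in> carrier_mat d d" "L_mat p \<Gamma> \<in> carrier_mat (p * d) (p * d)"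
  shows "L_mat (Suc p) \<Gamma> =
    four_block_mat \<Gamma> (0\<^sub>m d (p * d)) (0\<^sub>m (p * d) d) (L_mat p \<Gamma>)"
  using assms by (simp add: L_mat_def Let_def)

lemma L_mat_carrier:
  assumes "\<Gamma> \<in> carrier_mat d d"
  shows "L_mat p \<Gamma> \<in> carrier_mat (p * d) (p * d)"
proof (induction p)
  case (Suc p)
  then show ?case
    using assms by (simp only: L_mat_Suc[OF assms Suc]) (auto simp: add.commute)
qed (simp add: L_mat_def)

lemma L_mat_index:
  assumes \<Gamma>: "\<Gamma> \<in> carrier_mat d d" and "r < p * d" "c < p * d"
  shows "L_mat p \<Gamma> $$ (r, c) = (if r div d = c div d then \<Gamma> $$ (r mod d, c mod d) else 0)"
  using assms(2,3)
proof (induction p arbitrary: r c)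
  case (Suc p)
  have "d > 0"
    using Suc.prems by (intro gr0I) auto
  \<comment> \<open>Past the first block an index drops by d, which lowers its quotient by one and
    keeps its remainder.\<close>
  then show ?case
    unfolding L_mat_Suc[OF \<Gamma> L_mat_carrier[OF \<Gamma>]]
    using \<Gamma> L_mat_carrier[OF \<Gamma>, of p] Suc.prems
    by (auto simp: Suc.IH le_div_geq le_mod_geq not_less)
qed simp

lemma L_mat_mult_inverse:
  fixes \<Gamma> \<Delta> :: "real mat"
  assumes \<Gamma>: "\<Gamma> \<in> carrier_mat d d" and \<Delta>: "\<Delta> \<in> carrier_mat d d" and inv: "\<Gamma> * \<Delta> = 1\<^sub>m d"
  shows "L_mat p \<Gamma> * L_mat p \<Delta> = 1\<^sub>m (p * d)"
proof (induction p)
  case (Suc p)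
  note c = L_mat_carrier[OF \<Gamma>, of p] L_mat_carrier[OF \<Delta>, of p]
  show ?case
    unfolding L_mat_Suc[OF \<Gamma> c(1)] L_mat_Suc[OF \<Delta> c(2)]
    by (subst mult_four_block_mat[OF \<Gamma> _ _ c(1) \<Delta> _ _ c(2)])
      (use \<Gamma> \<Delta> c in \<open>auto simp: inv Suc.IH left_mult_zero_mat[OF c(2)] left_mult_zero_mat[OF \<Delta>]
        right_mult_zero_mat[OF c(1)] right_mult_zero_mat[OF \<Gamma>]\<close>)
qed (auto simp: L_mat_def)

section \<open>Block Toeplitz columns and the series for H\<close>

text \<open>The $l$-th block column of the one-sided infinite block Toeplitz matrix with blocks
  $P_{l-i}$; \<open>\<Pi>\<close> consists of the block columns $p+1,\dots,p+q$.\<close>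

definition block_col :: "nat \<Rightarrow> nat \<Rightarrow> (int \<Rightarrow> real mat) \<Rightarrow> nat \<Rightarrow> real mat" where
  "block_col d q P l = mat (q * d) d (\<lambda>(r, c). P (int l - int (r div d + 1)) $$ (r mod d, c))"

text \<open>This is all that the argument takes from B^{-1}(A - I): its coefficients vanish at
  indices k \<le> 0 and are absolutely summable entrywise.\<close>

locale toeplitz =
  fixes d p q :: nat and P :: "int \<Rightarrow> real mat" and \<Gamma> :: "real mat"
  assumes P: "\<And>k. P k \<in> carrier_mat d d"
    and P_nonpos: "\<And>k. k \<le> 0 \<Longrightarrow> P k = 0\<^sub>m d d"
    and P_summable: "\<And>a b. a < d \<Longrightarrow> b < d \<Longrightarrow> summable (\<lambda>n. \<bar>P (int n) $$ (a, b)\<bar>)"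
    and \<Gamma>: "sym_pos_def d \<Gamma>"
begin

lemma \<Gamma>_carrier: "\<Gamma> \<in> carrier_mat d d" and \<Gamma>_sym: "\<Gamma>\<^sup>T = \<Gamma>"
  and \<Gamma>_pos: "v \<in> carrier_vec d \<Longrightarrow> v \<noteq> 0\<^sub>v d \<Longrightarrow> v \<bullet> (\<Gamma> *\<^sub>v v) > 0"
  using \<Gamma> by (auto simp: sym_pos_def_def)

lemma \<Gamma>_nonneg: "v \<in> carrier_vec d \<Longrightarrow> v \<bullet> (\<Gamma> *\<^sub>v v) \<ge> 0"
  using \<Gamma>_pos[of v] \<Gamma>_carrier by (cases "v = 0\<^sub>v d") auto

lemma L_det: "det (L_mat p \<Gamma>) \<noteq> 0"
proof -
  have "det \<Gamma> \<noteq> 0"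
    using det_nonzero_if_quadratic_form_pos[OF \<Gamma>_carrier \<Gamma>_pos] .
  note inv = inv_mat[OF \<Gamma>_carrier this]
  show ?thesis
    using inv_mat_eqI(1)[OF L_mat_carrier L_mat_carrier L_mat_mult_inverse] \<Gamma>_carrier inv by blast
qed

text \<open>Each entry is a finite linear combination of products of two shifted, absolutely
  summable coefficient sequences.\<close>

lemma summable_index:
  assumes "a < d" "b < d"
  shows "summable (\<lambda>n. (P (int (n + u)) * \<Gamma> * (P (int (n + v)))\<^sup>T) $$ (a, b))"
proof -
  have shift: "summable (\<lambda>n. \<bar>P (int (n + u)) $$ (a, b)\<bar>)" if "a < d" "b < d" for a b u
    using summable_ignore_initial_segment[OF P_summable[OF that], of u] by simp
  have "(\<lambda>n. (P (int (n + u)) * \<Gamma> * (P (int (n + v)))\<^sup>T) $$ (a, b)) =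
    (\<lambda>n. \<Sum>e<d. \<Sum>c<d. \<Gamma> $$ (c, e) * (P (int (n + u)) $$ (a, c) * P (int (n + v)) $$ (b, e)))"
    unfolding index_mult_mult_transpose[OF P \<Gamma>_carrier P assms] sum_distrib_right
    by (simp only: mult_ac)
  then show ?thesis
    using assms by (simp only:) (intro summable_sum summable_mult summable_mult_abs shift; simp)
qed

text \<open>The common summand of H and K L^{-1} K^t: its (i,j) block is P_{l-i} \<Gamma>
  P_{l-j}^t.\<close>

abbreviation gram :: "nat \<Rightarrow> real mat" where
  "gram l \<equiv> block_col d q P l * \<Gamma> * (block_col d q P l)\<^sup>T"

lemma block_col_carrier: "block_col d q P l \<in> carrier_mat (q * d) d"
  by (simp add: block_col_def)

lemma gram_carrier: "gram l \<in> carrier_mat (q * d) (q * d)"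
  using block_col_carrier \<Gamma>_carrier by (metis mult_carrier_mat transpose_carrier_mat)

lemma gram_index:
  assumes "r < q * d" "s < q * d"
  shows "gram l $$ (r, s) =
    (P (int l - int (r div d + 1)) * \<Gamma> * (P (int l - int (s div d + 1)))\<^sup>T) $$ (r mod d, s mod d)"
proof -
  note less = block_index_less[OF assms(1)] block_index_less[OF assms(2)]
  show ?thesis
    unfolding index_mult_mult_transpose[OF block_col_carrier \<Gamma>_carrier block_col_carrier assms]
      index_mult_mult_transpose[OF P \<Gamma>_carrier P less(2,4)]
    using assms by (simp add: block_col_def)
qed

text \<open>One of the two outer factors has an index \<le> 0. Hence the series for every block of H
  may start at l = 1.\<close>

lemma gram_index_zero:
  assumes "r < q * d" "s < q * d" "l \<le> r div d + 1 \<or> l \<le> s div d + 1"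
  shows "gram l $$ (r, s) = 0"
  using assms(3) block_index_less[OF assms(1)] block_index_less[OF assms(2)] P_nonpos
  by (auto simp: gram_index[OF assms(1,2)] index_mult_mult_transpose[OF P \<Gamma>_carrier P])

text \<open>For i \<le> j the terms with l \<le> j vanish, and l = n + j + 1 gives P_{n+1+j-i}
  \<Gamma> P_{n+1}^t, the n-th summand of H_{j-i+1}.\<close>

lemma sums_H:
  assumes r: "r < q * d" and s: "s < q * d"
  shows "(\<lambda>n. gram (Suc n) $$ (r, s)) sums (H_mat d q P \<Gamma> $$ (r, s))"
proof -
  let ?i = "r div d + 1" and ?j = "s div d + 1"
  note less = block_index_less[OF r] block_index_less[OF s]
  show ?thesis
  proof (cases "?i \<le> ?j")
    case True
    have "gram (Suc (n + ?j)) $$ (r, s) =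
      (P (int (n + (?j - ?i + 1))) * \<Gamma> * (P (int (n + 1)))\<^sup>T) $$ (r mod d, s mod d)" for n
    proof -
      have "int (Suc (n + ?j)) - int ?i = int (n + (?j - ?i + 1))"
        "int (Suc (n + ?j)) - int ?j = int (n + 1)"
        using True by auto
      then show ?thesis
        unfolding gram_index[OF r s] by (simp only:)
    qed
    moreover have "H_mat d q P \<Gamma> $$ (r, s) =
      (\<Sum>n. (P (int (n + (?j - ?i + 1))) * \<Gamma> * (P (int (n + 1)))\<^sup>T) $$ (r mod d, s mod d))"
      using r s less True by (simp add: H_mat_def block_mat_def H_coeff_def)
    ultimately have "(\<lambda>n. gram (Suc (n + ?j)) $$ (r, s)) sums (H_mat d q P \<Gamma> $$ (r, s))"
      using summable_sums[OF summable_index[OF less(2,4)]] by presburger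
    then show ?thesis
      by (subst (asm) sums_zero_iff_shift) (auto intro!: gram_index_zero[OF r s])
  next
    \<comment> \<open>Now the terms with l \<le> i vanish, and symmetry of \<Gamma> turns the
      remaining ones into transposed summands of H_{i-j+1}.\<close>
    case False
    have "gram (Suc (n + ?i)) $$ (r, s) =
      (P (int (n + (?i - ?j + 1))) * \<Gamma> * (P (int (n + 1)))\<^sup>T) $$ (s mod d, r mod d)" for n
    proof -
      have "int (Suc (n + ?i)) - int ?i = int (n + 1)"
        "int (Suc (n + ?i)) - int ?j = int (n + (?i - ?j + 1))"
        using False by auto
      then show ?thesis
        unfolding gram_index[OF r s]
          index_mult_mult_transpose_sym[OF P \<Gamma>_carrier P less(2,4) \<Gamma>_sym] by (simp only:)
    qed
    moreover have "H_mat d q P \<Gamma> $$ (r, s) =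
      (\<Sum>n. (P (int (n + (?i - ?j + 1))) * \<Gamma> * (P (int (n + 1)))\<^sup>T) $$ (s mod d, r mod d))"
      using r s less False by (simp add: H_mat_def block_mat_def H_coeff_def)
    ultimately have "(\<lambda>n. gram (Suc (n + ?i)) $$ (r, s)) sums (H_mat d q P \<Gamma> $$ (r, s))"
      using summable_sums[OF summable_index[OF less(4,2)]] by presburger
    then show ?thesis
      by (subst (asm) sums_zero_iff_shift) (auto intro!: gram_index_zero[OF r s])
  qed
qed

section \<open>The matrix K and the Schur complement\<close>

text \<open>This is K L^{-1}, that is, K without the factor \<Gamma> in each block. The branch j
  \<le> i of K is absorbed by P_{j-i} = 0.\<close>

definition K0 :: "real mat" where
  "K0 = block_mat d q p (\<lambda>i j. P (int j - int i))"

lemma K0_carrier: "K0 \<in> carrier_mat (q * d) (p * d)"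
  by (simp add: K0_def block_mat_def)

lemma K_carrier: "K_mat d p q P \<Gamma> \<in> carrier_mat (q * d) (p * d)"
  by (simp add: K_mat_def block_mat_def)

lemma H_carrier: "H_mat d q P \<Gamma> \<in> carrier_mat (q * d) (q * d)"
  by (simp add: H_mat_def block_mat_def)

lemma K_index:
  assumes r: "r < q * d" and c: "c < p * d"
  shows "K_mat d p q P \<Gamma> $$ (r, c) =
    (\<Sum>k<d. P (int (c div d + 1) - int (r div d + 1)) $$ (r mod d, k) * \<Gamma> $$ (k, c mod d))"
proof -
  note less = block_index_less[OF r] block_index_less[OF c]
  have "K_mat d p q P \<Gamma> $$ (r, c) =
    (P (int (c div d + 1) - int (r div d + 1)) * \<Gamma>) $$ (r mod d, c mod d)"
    using r c less \<Gamma>_carrier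
    by (auto simp: K_mat_def block_mat_def P_nonpos left_mult_zero_mat)
  then show ?thesis
    using less P \<Gamma>_carrier carrier_matD[OF P] by (simp add: scalar_prod_def atLeast0LessThan)
qed

lemma K_eq: "K_mat d p q P \<Gamma> = K0 * L_mat p \<Gamma>"
proof (rule eq_matI)
  fix r c
  assume "r < dim_row (K0 * L_mat p \<Gamma>)" "c < dim_col (K0 * L_mat p \<Gamma>)"
  then have r: "r < q * d" and c: "c < p * d"
    using K0_carrier L_mat_carrier[OF \<Gamma>_carrier, of p] by auto
  note less = block_index_less[OF r] block_index_less[OF c]
  have "(K0 * L_mat p \<Gamma>) $$ (r, c) = (\<Sum>k<p * d. K0 $$ (r, k) * L_mat p \<Gamma> $$ (k, c))"
    using r c K0_carrier L_mat_carrier[OF \<Gamma>_carrier, of p]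
    by (simp add: scalar_prod_def atLeast0LessThan)
  also have "\<dots> = (\<Sum>l<p. \<Sum>k<d. K0 $$ (r, l * d + k) * L_mat p \<Gamma> $$ (l * d + k, c))"
    by (rule sum_lessThan_times)
  \<comment> \<open>L is block diagonal, so only the block row of L that holds the diagonal block of
    column c contributes.\<close>
  also have "\<dots> = (\<Sum>l<p. if l = c div d then
      (\<Sum>k<d. P (int (l + 1) - int (r div d + 1)) $$ (r mod d, k) * \<Gamma> $$ (k, c mod d)) else 0)"
    using r c index_of_block_less by (intro sum.cong refl)
      (auto simp: K0_def block_mat_def L_mat_index[OF \<Gamma>_carrier])
  also have "\<dots> = K_mat d p q P \<Gamma> $$ (r, c)"
    using less by (simp add: K_index[OF r c])
  finally show "K_mat d p q P \<Gamma> $$ (r, c) = (K0 * L_mat p \<Gamma>) $$ (r, c)" ..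
qed (use K0_carrier K_carrier L_mat_carrier[OF \<Gamma>_carrier, of p] in auto)

text \<open>Since K = \<open>K0\<close> L, the product is \<open>K0\<close> K^t, and block column l
  contributes P_{l-i} (P_{l-j} \<Gamma>)^t = P_{l-i} \<Gamma> P_{l-j}^t.\<close>

lemma K_inv_K_index:
  assumes r: "r < q * d" and s: "s < q * d"
  shows "(K_mat d p q P \<Gamma> * inv_mat (L_mat p \<Gamma>) * (K_mat d p q P \<Gamma>)\<^sup>T) $$ (r, s) =
    (\<Sum>l<p. gram (Suc l) $$ (r, s))"
proof -
  let ?K = "K_mat d p q P \<Gamma>" and ?L = "L_mat p \<Gamma>"
  note L = L_mat_carrier[OF \<Gamma>_carrier, of p]
  note inv = inv_mat[OF L L_det]
  note less = block_index_less[OF r] block_index_less[OF s]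
  have "?K * inv_mat ?L = K0 * (?L * inv_mat ?L)"
    unfolding K_eq by (rule assoc_mult_mat[OF K0_carrier L inv(1)])
  then have "?K * inv_mat ?L = K0"
    using inv(2) K0_carrier by simp
  then have "(?K * inv_mat ?L * ?K\<^sup>T) $$ (r, s) = (\<Sum>k<p * d. K0 $$ (r, k) * ?K $$ (s, k))"
    using r s K0_carrier K_carrier by (simp add: scalar_prod_def atLeast0LessThan)
  also have "\<dots> = (\<Sum>l<p. \<Sum>k<d. K0 $$ (r, l * d + k) * ?K $$ (s, l * d + k))"
    by (rule sum_lessThan_times)
  also have "\<dots> = (\<Sum>l<p. \<Sum>k<d. (\<Sum>e<d. P (int (l + 1) - int (s div d + 1)) $$ (s mod d, e)
      * \<Gamma> $$ (e, k)) * P (int (l + 1) - int (r div d + 1)) $$ (r mod d, k))"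
    using r s index_of_block_less by (intro sum.cong refl)
      (auto simp: K0_def block_mat_def K_index mult.commute[of "P _ $$ _"])
  also have "\<dots> = (\<Sum>l<p. gram (Suc l) $$ (r, s))"
    unfolding gram_index[OF r s] index_mult_mult_transpose_sym[OF P \<Gamma>_carrier P less(2,4) \<Gamma>_sym]
      index_mult_mult_transpose[OF P \<Gamma>_carrier P less(4,2)]
    by simp
  finally show ?thesis .
qed

definition schur :: "real mat" where
  "schur = H_mat d q P \<Gamma> - K_mat d p q P \<Gamma> * inv_mat (L_mat p \<Gamma>) * (K_mat d p q P \<Gamma>)\<^sup>T"

lemma schur_carrier: "schur \<in> carrier_mat (q * d) (q * d)"
  unfolding schur_def using K_carrier inv_mat(1)[OF L_mat_carrier[OF \<Gamma>_carrier] L_det]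
  by (metis minus_carrier_mat mult_carrier_mat transpose_carrier_mat)

text \<open>The subtracted product consists of exactly the first p terms of the series for H, so the
  tail l > p remains.\<close>

lemma sums_schur:
  assumes r: "r < q * d" and s: "s < q * d"
  shows "(\<lambda>n. gram (Suc (n + p)) $$ (r, s)) sums (schur $$ (r, s))"
proof -
  have "schur $$ (r, s) = H_mat d q P \<Gamma> $$ (r, s) - (\<Sum>l<p. gram (Suc l) $$ (r, s))"
    unfolding schur_def K_inv_K_index[OF r s, symmetric]
    using r s K_carrier by (intro index_minus_mat) auto
  then show ?thesis
    using sums_split_initial_segment[OF sums_H[OF r s], of p] by simp
qed

section \<open>Positivity of the Schur complement\<close>

lemma gram_quadratic_form:
  assumes v: "v \<in> carrier_vec (q * d)"
  defines "w \<equiv> \<lambda>l. (block_col d q P l)\<^sup>T *\<^sub>v v"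
  shows "v \<bullet> (gram l *\<^sub>v v) = w l \<bullet> (\<Gamma> *\<^sub>v w l)"
proof -
  let ?G = "block_col d q P l"
  have w: "w l \<in> carrier_vec d"
    unfolding w_def using block_col_carrier v by (metis mult_mat_vec_carrier transpose_carrier_mat)
  have "gram l *\<^sub>v v = ?G *\<^sub>v (\<Gamma> *\<^sub>v w l)"
    using assoc_mult_mat_vec[of "?G * \<Gamma>" "q * d" d "?G\<^sup>T" "q * d" v]
      assoc_mult_mat_vec[of ?G "q * d" d \<Gamma> d "w l"] block_col_carrier[of l] \<Gamma>_carrier v w
    by (simp add: w_def)
  then show ?thesis
    using transpose_vec_mult_scalar[OF block_col_carrier _ v, of "\<Gamma> *\<^sub>v w l" l] \<Gamma>_carrier w
    by (simp add: w_def)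
qed

lemma schur_pos:
  assumes det: "det (Pi_mat d p q P) \<noteq> 0" and v: "v \<in> carrier_vec (q * d)" "v \<noteq> 0\<^sub>v (q * d)"
  shows "v \<bullet> (schur *\<^sub>v v) > 0"
proof (rule ccontr)
  assume neg: "\<not> ?thesis"
  define w where "w = (\<lambda>l. (block_col d q P l)\<^sup>T *\<^sub>v v)"
  have w: "w l \<in> carrier_vec d" for l
    unfolding w_def using block_col_carrier v by (metis mult_mat_vec_carrier transpose_carrier_mat)
  have sums: "(\<lambda>n. w (Suc (n + p)) \<bullet> (\<Gamma> *\<^sub>v w (Suc (n + p)))) sums (v \<bullet> (schur *\<^sub>v v))"
    using sums_quadratic_form[OF schur_carrier gram_carrier sums_schur v(1)]
    unfolding gram_quadratic_form[OF v(1)] w_def by simp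
  \<comment> \<open>Every term is nonnegative and at most the total, which is \<le> 0 by
    \<open>neg\<close>.\<close>
  have "w (Suc (n + p)) \<bullet> (\<Gamma> *\<^sub>v w (Suc (n + p))) = 0" for n
  proof -
    have "w (Suc (n + p)) \<bullet> (\<Gamma> *\<^sub>v w (Suc (n + p))) \<le> v \<bullet> (schur *\<^sub>v v)"
      using sum_le_suminf[OF sums_summable[OF sums], of "{n}"] sums_unique[OF sums] \<Gamma>_nonneg[OF w]
      by simp
    then show ?thesis
      using neg \<Gamma>_nonneg[OF w, of "Suc (n + p)"] by simp
  qed
  then have w0: "w (Suc (n + p)) = 0\<^sub>v d" for n
    using \<Gamma>_pos[OF w] by (metis less_irrefl)
  have Pi: "Pi_mat d p q P \<in> carrier_mat (q * d) (q * d)"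
    by (simp add: Pi_mat_def block_mat_def)
  have "(Pi_mat d p q P)\<^sup>T *\<^sub>v v = 0\<^sub>v (q * d)"
  proof (rule eq_vecI)
    fix k
    assume "k < dim_vec (0\<^sub>v (q * d) :: real vec)"
    then have k: "k < q * d" by simp
    note less = block_index_less[OF k]
    \<comment> \<open>Column k lies in block column j = \<open>k div d + 1\<close> of \<Pi>, whose
      blocks P_{p+j-i} are those of the Toeplitz column p + j =
      \<open>Suc (k div d + p)\<close>.\<close>
    have "col (Pi_mat d p q P) k = col (block_col d q P (Suc (k div d + p))) (k mod d)"
      using k less by (intro eq_vecI) (auto simp: Pi_mat_def block_mat_def block_col_def add_ac)
    then have "vec_index ((Pi_mat d p q P)\<^sup>T *\<^sub>v v) k = vec_index (w (Suc (k div d + p))) (k mod d)"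
      using k less Pi block_col_carrier[of "Suc (k div d + p)"] by (simp add: w_def)
    then show "vec_index ((Pi_mat d p q P)\<^sup>T *\<^sub>v v) k = vec_index (0\<^sub>v (q * d)) k"
      using k less by (simp add: w0)
  qed (use Pi in simp)
  moreover have "det ((Pi_mat d p q P)\<^sup>T) \<noteq> 0"
    using det det_transpose[OF Pi] by simp
  ultimately show False
    using det_0_iff_vec_prod_zero[OF transpose_carrier_mat[THEN iffD2, OF Pi]] Pi v by blast
qed

end

section \<open>Invertibility of S and \<Lambda>, and the inverse of \<Lambda>\<close>

theorem lemma2p2:
  fixes d p q :: nat
    and A B :: "nat \<Rightarrow> real mat"
    and P :: "int \<Rightarrow> real mat"
    and \<Gamma> L K H \<Lambda> S :: "real mat"
  assumes "d \<ge> 1" and "p \<ge> 1" and "q \<ge> 1"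
    and "\<And>i. i \<in> {1..p} \<Longrightarrow> A i \<in> carrier_mat d d"
    and "\<And>j. j \<in> {1..q} \<Longrightarrow> B j \<in> carrier_mat d d"
    and "sym_pos_def d \<Gamma>"
    and "\<And>z::complex. norm z \<le> 1 \<Longrightarrow> det (B_poly d q B z) \<noteq> 0"
    and "P = P_coeff d p q A B"
    and "L = L_mat p \<Gamma>"
    and "K = K_mat d p q P \<Gamma>"
    and "H = H_mat d q P \<Gamma>"
    and "\<Lambda> = four_block_mat L (K\<^sup>T) K H"
    and "S = H - K * inv_mat L * K\<^sup>T"
    and "det (Pi_mat d p q P) \<noteq> 0"
  shows "invertible_mat S \<and> invertible_mat \<Lambda> \<and>
    inv_mat \<Lambda> = four_block_mat
      (inv_mat L + inv_mat L * K\<^sup>T * inv_mat S * K * inv_mat L)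
      (- (inv_mat L * K\<^sup>T * inv_mat S))
      (- (inv_mat S * K * inv_mat L))
      (inv_mat S)"
proof -
  \<comment> \<open>The condition on det B(z) enters here, through the summability of the
    coefficients.\<close>
  interpret toeplitz d p q P \<Gamma>
    using assms(6,8) P_coeff_carrier P_coeff_nonpos summable_P_coeff[OF assms(7)]
    by unfold_locales auto
  have S_eq: "S = toeplitz.schur d p q P \<Gamma>"
    by (simp only: schur_def assms(9-11,13))
  have L: "L \<in> carrier_mat (p * d) (p * d)" and detL: "det L \<noteq> 0"
    using L_mat_carrier[OF \<Gamma>_carrier] L_det by (auto simp: assms(9))
  have K: "K \<in> carrier_mat (q * d) (p * d)" and H: "H \<in> carrier_mat (q * d) (q * d)"
    using K_carrier H_carrier by (auto simp: assms(10,11))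
  have S: "S \<in> carrier_mat (q * d) (q * d)"
    using schur_carrier S_eq by simp
  have detS: "det S \<noteq> 0"
    unfolding S_eq by (rule det_nonzero_if_quadratic_form_pos[OF schur_carrier schur_pos[OF assms(14)]])
  note Li = inv_mat(1)[OF L detL] and Si = inv_mat(1)[OF S detS]
  let ?X = "four_block_mat
      (inv_mat L + inv_mat L * K\<^sup>T * inv_mat S * K * inv_mat L)
      (- (inv_mat L * K\<^sup>T * inv_mat S))
      (- (inv_mat S * K * inv_mat L))
      (inv_mat S)"
  have \<Lambda>: "\<Lambda> \<in> carrier_mat (p * d + q * d) (p * d + q * d)"
    unfolding assms(12) by (rule four_block_carrier_mat[OF L H])
  have X: "?X \<in> carrier_mat (p * d + q * d) (p * d + q * d)"
    using Li Si K by (intro four_block_carrier_mat) auto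
  have "\<Lambda> * ?X = 1\<^sub>m (p * d + q * d)"
    unfolding assms(12)
    by (rule four_block_mat_schur_inverse[OF L _ K H assms(13) detL detS]) (use K in simp)
  \<comment> \<open>This one product yields both det \<Lambda> \<noteq> 0 and the formula for the
    inverse.\<close>
  from inv_mat_eqI[OF \<Lambda> X this] show ?thesis
    using invertible_mat_if_det_nonzero[OF S detS] invertible_mat_if_det_nonzero[OF \<Lambda>] by blast
qed

end
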